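(* Let $\mathbb{X}$ be an additive linear category with monoidal coalgebra modality $(!,\delta,\varepsilon,m_\otimes,m_K,\Delta,e)$. Define $$\nabla:=(\delta\otimes\delta)\,m_\otimes\,!(\varepsilon\otimes e+e\otimes\varepsilon):{!A}\otimes{!A}\to{!A},\qquad u:=m_K\,!(0):K\to{!A}.$$ Then $(!,\delta,\varepsilon,\Delta,e,\nabla,u)$ is an additive bialgebra modality.
   Context: Composition is in diagrammatic order ($fg$ means first $f$, then $g$). Symmetric monoidal categories are treated as strict (associators and unitors suppressed), with tensor $\otimes$, unit $K$, symmetry $\sigma:A\otimes B\to B\otimes A$. An additive symmetric monoidal category is a symmetric monoidal category enriched in commutative monoids (hom-sets have $+$ and $0$, no negatives, no biproducts assumed), with composition and $\otimes$ preserving $+$ and $0$ in each variable. A coalgebra modality $(!,\delta,\varepsilon,\Delta,e)$ is a comonad $(!,\delta,\varepsilon)$, $\delta:{!A}\to{!!A}$, $\varepsilon:{!A}\to A$, with natural transformations $\Delta:{!A}\to{!A}\otimes{!A}$, $e:{!A}\to K$ such that each $({!A},\Delta,e)$ is a cocommutative comonoid and $\delta\Delta=\Delta(\delta\otimes\delta)$. A monoidal coalgebra modality $(!,\delta,\varepsilon,m_\otimes,m_K,\Delta,e)$ is a coalgebra modality with a natural transformation $m_\otimes:{!A}\otimes{!B}\to{!(A\otimes B)}$ and a map $m_K:K\to{!K}$ such that: $(!,m_\otimes,m_K)$ is a (lax) symmetric monoidal endofunctor; $\delta,\varepsilon$ are monoidal: $m_\otimes\delta=(\delta\otimes\delta)m_\otimes!(m_\otimes)$,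 $m_K\delta=m_K!(m_K)$, $m_\otimes\varepsilon=\varepsilon\otimes\varepsilon$, $m_K\varepsilon=1$; $\Delta,e$ are monoidal: $m_\otimes\Delta=(\Delta\otimes\Delta)(1\otimes\sigma\otimes1)(m_\otimes\otimes m_\otimes)$, $m_\otimes e=e\otimes e$, $m_K\Delta=m_K\otimes m_K$, $m_Ke=1$; and $\Delta,e$ are $!$-coalgebra morphisms: $\delta\,!(\Delta)=\Delta(\delta\otimes\delta)m_\otimes$, $\delta\,!(e)=e\,m_K$. An additive linear category is an additive symmetric monoidal category equipped with a monoidal coalgebra modality. A bialgebra modality $(!,\delta,\varepsilon,\Delta,e,\nabla,u)$ is a coalgebra modality with natural transformations $\nabla:{!A}\otimes{!A}\to{!A}$, $u:K\to{!A}$ such that $({!A},\nabla,u)$ is a commutative monoid, $\nabla e=e\otimes e$, $u\Delta=u\otimes u$, $ue=1$, $\nabla\Delta=(\Delta\otimes\Delta)(1\otimes\sigma\otimes1)(\nabla\otimes\nabla)$, and $\nabla\varepsilon=\varepsilon\otimes e+e\otimes\varepsilon$. It is additive if for all parallel maps $f,g$: $!(f+g)=\Delta(!(f)\otimes!(g))\nabla$ and $!(0)=eu$. *)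

theory Defs
  imports Main
begin

section \<open>Strict symmetric monoidal categories, additive case\<close>

text \<open>
  Objects and arrows are carriers in two types; each arrow determines its source and target.
  The operations are total functions whose values outside the carriers (or on non-composable
  or non-parallel arrows) are irrelevant: every axiom below is guarded.
  Composition is in diagrammatic order: \<open>f \<cdot> g\<close> is first \<open>f\<close>, then \<open>g\<close>.
\<close>

record ('o, 'a) category =
  Obj :: "'o set"
  Arr :: "'a set"
  src :: "'a \<Rightarrow> 'o"
  tgt :: "'a \<Rightarrow> 'o"
  ident :: "'o \<Rightarrow> 'a"  ("\<one>\<index>")
  comp :: "'a \<Rightarrow> 'a \<Rightarrow> 'a"  (infixl "\<cdot>\<index>" 70)

definition hom :: "('o, 'a, 'm) category_scheme \<Rightarrow> 'o \<Rightarrow> 'o \<Rightarrow> 'a set"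
  where "hom X A B = {f \<in> Arr X. src X f = A \<and> tgt X f = B}"

locale category =
  fixes X :: "('o, 'a, 'm) category_scheme" (structure)
  assumes src_Obj: "f \<in> Arr X \<Longrightarrow> src X f \<in> Obj X"
    and tgt_Obj: "f \<in> Arr X \<Longrightarrow> tgt X f \<in> Obj X"
    and ident_hom: "A \<in> Obj X \<Longrightarrow> \<one> A \<in> hom X A A"
    and comp_hom: "\<lbrakk>f \<in> hom X A B; g \<in> hom X B C\<rbrakk> \<Longrightarrow> f \<cdot> g \<in> hom X A C"
    and comp_ident_left: "f \<in> hom X A B \<Longrightarrow> \<one> A \<cdot> f = f"
    and comp_ident_right: "f \<in> hom X A B \<Longrightarrow> f \<cdot> \<one> B = f"
    and comp_assoc:
      "\<lbrakk>f \<in> hom X A B; g \<in> hom X B C; h \<in> hom X C D\<rbrakk> \<Longrightarrow> (f \<cdot> g) \<cdot> h = f \<cdot> (g \<cdot> h)"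

text \<open>
  The tensor product is written \<open>A \<odot> B\<close> on objects and \<open>f \<otimes> g\<close> on arrows; the unit object
  is \<open>\<K>\<close> and the symmetry is \<open>\<sigma> A B : A \<odot> B \<rightarrow> B \<odot> A\<close>.
\<close>

record ('o, 'a) smcat = "('o, 'a) category" +
  tensor_obj :: "'o \<Rightarrow> 'o \<Rightarrow> 'o"  (infixl "\<odot>\<index>" 75)
  tensor_arr :: "'a \<Rightarrow> 'a \<Rightarrow> 'a"  (infixl "\<otimes>\<index>" 75)
  tensor_unit :: "'o"  ("\<K>\<index>")
  symmetry :: "'o \<Rightarrow> 'o \<Rightarrow> 'a"  ("\<sigma>\<index>")

text \<open>
  Associators and unitors are identities, so that associativity and unitality of the tensor
  product are equations on objects and on arrows. With strict unitors, the coherence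
  condition \<open>\<sigma> A \<K> = \<one> A\<close> is a consequence of the hexagon and involutivity.
\<close>

locale symmetric_monoidal_category = category X
  for X :: "('o, 'a, 'm) smcat_scheme" (structure) +
  assumes unit_Obj: "\<K> \<in> Obj X"
    and tensor_Obj: "\<lbrakk>A \<in> Obj X; B \<in> Obj X\<rbrakk> \<Longrightarrow> A \<odot> B \<in> Obj X"
    and tensor_obj_assoc:
      "\<lbrakk>A \<in> Obj X; B \<in> Obj X; C \<in> Obj X\<rbrakk> \<Longrightarrow> (A \<odot> B) \<odot> C = A \<odot> (B \<odot> C)"
    and tensor_obj_unit_left: "A \<in> Obj X \<Longrightarrow> \<K> \<odot> A = A"
    and tensor_obj_unit_right: "A \<in> Obj X \<Longrightarrow> A \<odot> \<K> = A"
    and tensor_hom: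
      "\<lbrakk>f \<in> hom X A B; g \<in> hom X C D\<rbrakk> \<Longrightarrow> f \<otimes> g \<in> hom X (A \<odot> C) (B \<odot> D)"
    and tensor_ident: "\<lbrakk>A \<in> Obj X; B \<in> Obj X\<rbrakk> \<Longrightarrow> \<one> A \<otimes> \<one> B = \<one> (A \<odot> B)"
    and tensor_comp:
      "\<lbrakk>f \<in> hom X A B; g \<in> hom X B C; h \<in> hom X D E; k \<in> hom X E F\<rbrakk>
        \<Longrightarrow> (f \<cdot> g) \<otimes> (h \<cdot> k) = (f \<otimes> h) \<cdot> (g \<otimes> k)"
    and tensor_arr_assoc:
      "\<lbrakk>f \<in> Arr X; g \<in> Arr X; h \<in> Arr X\<rbrakk> \<Longrightarrow> (f \<otimes> g) \<otimes> h = f \<otimes> (g \<otimes> h)"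
    and tensor_arr_unit_left: "f \<in> Arr X \<Longrightarrow> \<one> \<K> \<otimes> f = f"
    and tensor_arr_unit_right: "f \<in> Arr X \<Longrightarrow> f \<otimes> \<one> \<K> = f"
    and symmetry_hom: "\<lbrakk>A \<in> Obj X; B \<in> Obj X\<rbrakk> \<Longrightarrow> \<sigma> A B \<in> hom X (A \<odot> B) (B \<odot> A)"
    and symmetry_natural:
      "\<lbrakk>f \<in> hom X A B; g \<in> hom X C D\<rbrakk> \<Longrightarrow> (f \<otimes> g) \<cdot> \<sigma> B D = \<sigma> A C \<cdot> (g \<otimes> f)"
    and symmetry_involutive:
      "\<lbrakk>A \<in> Obj X; B \<in> Obj X\<rbrakk> \<Longrightarrow> \<sigma> A B \<cdot> \<sigma> B A = \<one> (A \<odot> B)"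
    and symmetry_hexagon:
      "\<lbrakk>A \<in> Obj X; B \<in> Obj X; C \<in> Obj X\<rbrakk>
        \<Longrightarrow> \<sigma> A (B \<odot> C) = (\<sigma> A B \<otimes> \<one> C) \<cdot> (\<one> B \<otimes> \<sigma> A C)"

record ('o, 'a) asmcat = "('o, 'a) smcat" +
  add_arr :: "'a \<Rightarrow> 'a \<Rightarrow> 'a"  (infixl "\<oplus>\<index>" 65)
  zero_arr :: "'o \<Rightarrow> 'o \<Rightarrow> 'a"  ("\<zero>\<index>")

locale additive_symmetric_monoidal_category = symmetric_monoidal_category X
  for X :: "('o, 'a, 'm) asmcat_scheme" (structure) +
  assumes zero_hom: "\<lbrakk>A \<in> Obj X; B \<in> Obj X\<rbrakk> \<Longrightarrow> \<zero> A B \<in> hom X A B"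
    and add_hom: "\<lbrakk>f \<in> hom X A B; g \<in> hom X A B\<rbrakk> \<Longrightarrow> f \<oplus> g \<in> hom X A B"
    and add_assoc:
      "\<lbrakk>f \<in> hom X A B; g \<in> hom X A B; h \<in> hom X A B\<rbrakk> \<Longrightarrow> (f \<oplus> g) \<oplus> h = f \<oplus> (g \<oplus> h)"
    and add_commute: "\<lbrakk>f \<in> hom X A B; g \<in> hom X A B\<rbrakk> \<Longrightarrow> f \<oplus> g = g \<oplus> f"
    and add_zero: "f \<in> hom X A B \<Longrightarrow> f \<oplus> \<zero> A B = f"
    and comp_add_left:
      "\<lbrakk>f \<in> hom X A B; g \<in> hom X A B; h \<in> hom X B C\<rbrakk> \<Longrightarrow> (f \<oplus> g) \<cdot> h = f \<cdot> h \<oplus> g \<cdot> h"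
    and comp_add_right:
      "\<lbrakk>f \<in> hom X A B; g \<in> hom X B C; h \<in> hom X B C\<rbrakk> \<Longrightarrow> f \<cdot> (g \<oplus> h) = f \<cdot> g \<oplus> f \<cdot> h"
    and comp_zero_left: "\<lbrakk>A \<in> Obj X; f \<in> hom X B C\<rbrakk> \<Longrightarrow> \<zero> A B \<cdot> f = \<zero> A C"
    and comp_zero_right: "\<lbrakk>f \<in> hom X A B; C \<in> Obj X\<rbrakk> \<Longrightarrow> f \<cdot> \<zero> B C = \<zero> A C"
    and tensor_add_left:
      "\<lbrakk>f \<in> hom X A B; g \<in> hom X A B; h \<in> hom X C D\<rbrakk> \<Longrightarrow> (f \<oplus> g) \<otimes> h = f \<otimes> h \<oplus> g \<otimes> h"
    and tensor_add_right:
      "\<lbrakk>f \<in> hom X A B; g \<in> hom X C D; h \<in> hom X C D\<rbrakk> \<Longrightarrow> f \<otimes> (g \<oplus> h) = f \<otimes> g \<oplus> f \<otimes> h"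
    and tensor_zero_left:
      "\<lbrakk>A \<in> Obj X; B \<in> Obj X; f \<in> hom X C D\<rbrakk> \<Longrightarrow> \<zero> A B \<otimes> f = \<zero> (A \<odot> C) (B \<odot> D)"
    and tensor_zero_right:
      "\<lbrakk>f \<in> hom X A B; C \<in> Obj X; D \<in> Obj X\<rbrakk> \<Longrightarrow> f \<otimes> \<zero> C D = \<zero> (A \<odot> C) (B \<odot> D)"

section \<open>Functors, comonads, comonoids and monoids\<close>

locale endofunctor = category X
  for X :: "('o, 'a, 'm) category_scheme" (structure) +
  fixes Fo :: "'o \<Rightarrow> 'o" and Fa :: "'a \<Rightarrow> 'a"
  assumes Fo_Obj: "A \<in> Obj X \<Longrightarrow> Fo A \<in> Obj X"
    and Fa_hom: "f \<in> hom X A B \<Longrightarrow> Fa f \<in> hom X (Fo A) (Fo B)"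
    and Fa_ident: "A \<in> Obj X \<Longrightarrow> Fa (\<one> A) = \<one> (Fo A)"
    and Fa_comp: "\<lbrakk>f \<in> hom X A B; g \<in> hom X B C\<rbrakk> \<Longrightarrow> Fa (f \<cdot> g) = Fa f \<cdot> Fa g"

locale natural_transformation =
  F: endofunctor X Fo Fa + G: endofunctor X Go Ga
  for X :: "('o, 'a, 'm) category_scheme" (structure) and Fo Fa Go Ga +
  fixes \<tau> :: "'o \<Rightarrow> 'a"
  assumes component_hom: "A \<in> Obj X \<Longrightarrow> \<tau> A \<in> hom X (Fo A) (Go A)"
    and naturality: "f \<in> hom X A B \<Longrightarrow> Fa f \<cdot> \<tau> B = \<tau> A \<cdot> Ga f"

text \<open>
  The endofunctor \<open>!\<close> is given by its action \<open>bo\<close> on objects and its action \<open>ba\<close> on arrows.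
\<close>

locale comonad =
  endofunctor X bo ba +
  \<delta>: natural_transformation X bo ba "\<lambda>A. bo (bo A)" "\<lambda>f. ba (ba f)" \<delta> +
  \<epsilon>: natural_transformation X bo ba "\<lambda>A. A" "\<lambda>f. f" \<epsilon>
  for X :: "('o, 'a, 'm) category_scheme" (structure) and bo ba \<delta> \<epsilon> +
  assumes counit_left: "A \<in> Obj X \<Longrightarrow> \<delta> A \<cdot> \<epsilon> (bo A) = \<one> (bo A)"
    and counit_right: "A \<in> Obj X \<Longrightarrow> \<delta> A \<cdot> ba (\<epsilon> A) = \<one> (bo A)"
    and coassoc: "A \<in> Obj X \<Longrightarrow> \<delta> A \<cdot> \<delta> (bo A) = \<delta> A \<cdot> ba (\<delta> A)"

locale cocommutative_comonoid = symmetric_monoidal_category X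
  for X :: "('o, 'a, 'm) smcat_scheme" (structure) +
  fixes A :: 'o and d :: 'a and c :: 'a
  assumes object: "A \<in> Obj X"
    and comult_hom: "d \<in> hom X A (A \<odot> A)"
    and counit_hom: "c \<in> hom X A \<K>"
    and comult_coassoc: "d \<cdot> (d \<otimes> \<one> A) = d \<cdot> (\<one> A \<otimes> d)"
    and comult_counit_left: "d \<cdot> (c \<otimes> \<one> A) = \<one> A"
    and comult_counit_right: "d \<cdot> (\<one> A \<otimes> c) = \<one> A"
    and comult_cocomm: "d \<cdot> \<sigma> A A = d"

locale commutative_monoid = symmetric_monoidal_category X
  for X :: "('o, 'a, 'm) smcat_scheme" (structure) +
  fixes A :: 'o and p :: 'a and j :: 'a
  assumes object: "A \<in> Obj X"
    and mult_hom: "p \<in> hom X (A \<odot> A) A"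
    and unit_hom: "j \<in> hom X \<K> A"
    and mult_assoc: "(p \<otimes> \<one> A) \<cdot> p = (\<one> A \<otimes> p) \<cdot> p"
    and mult_unit_left: "(j \<otimes> \<one> A) \<cdot> p = \<one> A"
    and mult_unit_right: "(\<one> A \<otimes> j) \<cdot> p = \<one> A"
    and mult_comm: "\<sigma> A A \<cdot> p = p"

locale symmetric_monoidal_endofunctor =
  symmetric_monoidal_category X + endofunctor X Fo Fa
  for X :: "('o, 'a, 'm) smcat_scheme" (structure) and Fo Fa +
  fixes m :: "'o \<Rightarrow> 'o \<Rightarrow> 'a" and m\<^sub>K :: 'a
  assumes m_hom: "\<lbrakk>A \<in> Obj X; B \<in> Obj X\<rbrakk> \<Longrightarrow> m A B \<in> hom X (Fo A \<odot> Fo B) (Fo (A \<odot> B))"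
    and m_natural:
      "\<lbrakk>f \<in> hom X A B; g \<in> hom X C D\<rbrakk> \<Longrightarrow> (Fa f \<otimes> Fa g) \<cdot> m B D = m A C \<cdot> Fa (f \<otimes> g)"
    and mK_hom: "m\<^sub>K \<in> hom X \<K> (Fo \<K>)"
    and m_assoc:
      "\<lbrakk>A \<in> Obj X; B \<in> Obj X; C \<in> Obj X\<rbrakk>
        \<Longrightarrow> (m A B \<otimes> \<one> (Fo C)) \<cdot> m (A \<odot> B) C = (\<one> (Fo A) \<otimes> m B C) \<cdot> m A (B \<odot> C)"
    and m_unit_left: "A \<in> Obj X \<Longrightarrow> (m\<^sub>K \<otimes> \<one> (Fo A)) \<cdot> m \<K> A = \<one> (Fo A)"
    and m_unit_right: "A \<in> Obj X \<Longrightarrow> (\<one> (Fo A) \<otimes> m\<^sub>K) \<cdot> m A \<K> = \<one> (Fo A)"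
    and m_symmetry:
      "\<lbrakk>A \<in> Obj X; B \<in> Obj X\<rbrakk> \<Longrightarrow> m A B \<cdot> Fa (\<sigma> A B) = \<sigma> (Fo A) (Fo B) \<cdot> m B A"

section \<open>Coalgebra modalities\<close>

locale coalgebra_modality =
  symmetric_monoidal_category X +
  comonad X bo ba \<delta> \<epsilon> +
  \<Delta>: natural_transformation X bo ba "\<lambda>A. bo A \<odot> bo A" "\<lambda>f. ba f \<otimes> ba f" \<Delta> +
  e: natural_transformation X bo ba "\<lambda>A. \<K>" "\<lambda>f. \<one> \<K>" e
  for X :: "('o, 'a, 'm) smcat_scheme" (structure) and bo ba \<delta> \<epsilon> \<Delta> e +
  assumes comonoid: "A \<in> Obj X \<Longrightarrow> cocommutative_comonoid X (bo A) (\<Delta> A) (e A)"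
    and \<delta>_\<Delta>: "A \<in> Obj X \<Longrightarrow> \<delta> A \<cdot> \<Delta> (bo A) = \<Delta> A \<cdot> (\<delta> A \<otimes> \<delta> A)"

locale monoidal_coalgebra_modality =
  coalgebra_modality X bo ba \<delta> \<epsilon> \<Delta> e +
  symmetric_monoidal_endofunctor X bo ba m m\<^sub>K
  for X :: "('o, 'a, 'm) smcat_scheme" (structure) and bo ba \<delta> \<epsilon> m m\<^sub>K \<Delta> e +
  assumes m_\<delta>:
      "\<lbrakk>A \<in> Obj X; B \<in> Obj X\<rbrakk>
        \<Longrightarrow> m A B \<cdot> \<delta> (A \<odot> B) = (\<delta> A \<otimes> \<delta> B) \<cdot> m (bo A) (bo B) \<cdot> ba (m A B)"
    and mK_\<delta>: "m\<^sub>K \<cdot> \<delta> \<K> = m\<^sub>K \<cdot> ba m\<^sub>K"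
    and m_\<epsilon>: "\<lbrakk>A \<in> Obj X; B \<in> Obj X\<rbrakk> \<Longrightarrow> m A B \<cdot> \<epsilon> (A \<odot> B) = \<epsilon> A \<otimes> \<epsilon> B"
    and mK_\<epsilon>: "m\<^sub>K \<cdot> \<epsilon> \<K> = \<one> \<K>"
    and m_\<Delta>:
      "\<lbrakk>A \<in> Obj X; B \<in> Obj X\<rbrakk>
        \<Longrightarrow> m A B \<cdot> \<Delta> (A \<odot> B)
            = (\<Delta> A \<otimes> \<Delta> B) \<cdot> (\<one> (bo A) \<otimes> \<sigma> (bo A) (bo B) \<otimes> \<one> (bo B)) \<cdot> (m A B \<otimes> m A B)"
    and m_e: "\<lbrakk>A \<in> Obj X; B \<in> Obj X\<rbrakk> \<Longrightarrow> m A B \<cdot> e (A \<odot> B) = e A \<otimes> e B"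
    and mK_\<Delta>: "m\<^sub>K \<cdot> \<Delta> \<K> = m\<^sub>K \<otimes> m\<^sub>K"
    and mK_e: "m\<^sub>K \<cdot> e \<K> = \<one> \<K>"
    and \<Delta>_coalgebra_morphism:
      "A \<in> Obj X \<Longrightarrow> \<delta> A \<cdot> ba (\<Delta> A) = \<Delta> A \<cdot> (\<delta> A \<otimes> \<delta> A) \<cdot> m (bo A) (bo A)"
    and e_coalgebra_morphism: "A \<in> Obj X \<Longrightarrow> \<delta> A \<cdot> ba (e A) = e A \<cdot> m\<^sub>K"

locale additive_linear_category =
  additive_symmetric_monoidal_category X +
  monoidal_coalgebra_modality X bo ba \<delta> \<epsilon> m m\<^sub>K \<Delta> e
  for X :: "('o, 'a, 'm) asmcat_scheme" (structure) and bo ba \<delta> \<epsilon> m m\<^sub>K \<Delta> e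

text \<open>
  The transformations \<open>\<nabla>\<close> and \<open>u\<close> of a bialgebra modality are the parameters \<open>p\<close> and \<open>u\<close>.
\<close>

locale bialgebra_modality =
  additive_symmetric_monoidal_category X +
  coalgebra_modality X bo ba \<delta> \<epsilon> \<Delta> e +
  p: natural_transformation X "\<lambda>A. bo A \<odot> bo A" "\<lambda>f. ba f \<otimes> ba f" bo ba p +
  u: natural_transformation X "\<lambda>A. \<K>" "\<lambda>f. \<one> \<K>" bo ba u
  for X :: "('o, 'a, 'm) asmcat_scheme" (structure) and bo ba \<delta> \<epsilon> \<Delta> e p u +
  assumes monoid: "A \<in> Obj X \<Longrightarrow> commutative_monoid X (bo A) (p A) (u A)"
    and p_e: "A \<in> Obj X \<Longrightarrow> p A \<cdot> e A = e A \<otimes> e A"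
    and u_\<Delta>: "A \<in> Obj X \<Longrightarrow> u A \<cdot> \<Delta> A = u A \<otimes> u A"
    and u_e: "A \<in> Obj X \<Longrightarrow> u A \<cdot> e A = \<one> \<K>"
    and p_\<Delta>:
      "A \<in> Obj X
        \<Longrightarrow> p A \<cdot> \<Delta> A
            = (\<Delta> A \<otimes> \<Delta> A) \<cdot> (\<one> (bo A) \<otimes> \<sigma> (bo A) (bo A) \<otimes> \<one> (bo A)) \<cdot> (p A \<otimes> p A)"
    and p_\<epsilon>: "A \<in> Obj X \<Longrightarrow> p A \<cdot> \<epsilon> A = \<epsilon> A \<otimes> e A \<oplus> e A \<otimes> \<epsilon> A"

locale additive_bialgebra_modality =
  bialgebra_modality X bo ba \<delta> \<epsilon> \<Delta> e p u
  for X :: "('o, 'a, 'm) asmcat_scheme" (structure) and bo ba \<delta> \<epsilon> \<Delta> e p u +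
  assumes bang_add:
      "\<lbrakk>f \<in> hom X A B; g \<in> hom X A B\<rbrakk> \<Longrightarrow> ba (f \<oplus> g) = \<Delta> A \<cdot> (ba f \<otimes> ba g) \<cdot> p B"
    and bang_zero: "\<lbrakk>A \<in> Obj X; B \<in> Obj X\<rbrakk> \<Longrightarrow> ba (\<zero> A B) = e A \<cdot> u B"

end

theory Submission
  imports Defs
begin

text \<open>
  A coalgebra morphism into a cofree coalgebra \<open>(!A, \<delta>)\<close> is determined by its composite with
  \<open>\<epsilon>\<close>. Coalgebras are closed under the tensor product, \<open>K\<close> is a coalgebra through \<open>m\<^sub>K\<close>, and
  \<open>\<nabla>\<close> and \<open>u\<close> are the coalgebra morphisms with \<open>\<nabla> \<epsilon> = \<epsilon> \<otimes> e + e \<otimes> \<epsilon>\<close> and \<open>u \<epsilon> = 0\<close>. So the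
  equations with values in \<open>!A\<close> may be checked after composing with \<open>\<epsilon>\<close>, where they are
  identities about sums. The compatibilities with \<open>\<Delta>\<close> and \<open>e\<close> hold because \<open>\<delta>\<close> and \<open>m\<close>
  preserve the comonoid structure.
\<close>

section \<open>Category axioms in a form suited to rewriting\<close>

context category
begin

text \<open>The axioms have premises in \<open>hom X A B\<close>, whose objects often do not occur
  in the equation. Stated through \<open>Arr\<close>, \<open>src\<close> and \<open>tgt\<close>, the
  premises become side conditions that the simplifier can discharge.\<close>

lemma hom_iff: "f \<in> hom X A B \<longleftrightarrow> f \<in> Arr X \<and> src X f = A \<and> tgt X f = B"
  by (simp add: hom_def)

lemma src_tgt_Obj [simp]:
  "f \<in> Arr X \<Longrightarrow> src X f \<in> Obj X" "f \<in> Arr X \<Longrightarrow> tgt X f \<in> Obj X"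
  by (fact src_Obj tgt_Obj)+

lemma ident_simps [simp]:
  assumes "A \<in> Obj X"
  shows "\<one> A \<in> Arr X" "src X (\<one> A) = A" "tgt X (\<one> A) = A"
  using ident_hom[OF assms] by (auto simp: hom_iff)

lemma comp_simps [simp]:
  assumes "f \<in> Arr X" "g \<in> Arr X" "tgt X f = src X g"
  shows "f \<cdot> g \<in> Arr X" "src X (f \<cdot> g) = src X f" "tgt X (f \<cdot> g) = tgt X g"
  using comp_hom[of f "src X f" "src X g" g "tgt X g"] assms by (auto simp: hom_iff)

lemma comp_ident_simps [simp]:
  "\<lbrakk>f \<in> Arr X; src X f = A\<rbrakk> \<Longrightarrow> \<one> A \<cdot> f = f"
  "\<lbrakk>f \<in> Arr X; tgt X f = B\<rbrakk> \<Longrightarrow> f \<cdot> \<one> B = f"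
  by (auto simp: hom_iff intro: comp_ident_left comp_ident_right)

lemma comp_assoc_simp [simp]:
  "\<lbrakk>f \<in> Arr X; g \<in> Arr X; h \<in> Arr X; tgt X f = src X g; tgt X g = src X h\<rbrakk>
    \<Longrightarrow> (f \<cdot> g) \<cdot> h = f \<cdot> (g \<cdot> h)"
  by (rule comp_assoc) (auto simp: hom_iff)

text \<open>Composites are normalised to right-nested form, where \<open>a \<cdot> b\<close> is no
  longer a subterm of \<open>a \<cdot> (b \<cdot> r)\<close>. This applies an equation for
  \<open>a \<cdot> b\<close> at that place.\<close>

lemma comp_rewrite:
  assumes "a \<cdot> b = c" "a \<in> Arr X" "b \<in> Arr X" "r \<in> Arr X" "tgt X a = src X b" "tgt X b = src X r"
  shows "a \<cdot> (b \<cdot> r) = c \<cdot> r"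
  using assms by (metis comp_assoc_simp)

end

section \<open>Interchange law and symmetry\<close>

context symmetric_monoidal_category
begin

declare unit_Obj [simp] tensor_Obj [simp] tensor_obj_assoc [simp]
  tensor_obj_unit_left [simp] tensor_obj_unit_right [simp]
  tensor_ident [simp] tensor_arr_assoc [simp]
  tensor_arr_unit_left [simp] tensor_arr_unit_right [simp]

lemma tensor_simps [simp]:
  assumes "f \<in> Arr X" "g \<in> Arr X"
  shows "f \<otimes> g \<in> Arr X" "src X (f \<otimes> g) = src X f \<odot> src X g"
    "tgt X (f \<otimes> g) = tgt X f \<odot> tgt X g"
  using tensor_hom[of f "src X f" "tgt X f" g "src X g" "tgt X g"] assms by (auto simp: hom_iff)

lemma symmetry_simps [simp]:
  assumes "A \<in> Obj X" "B \<in> Obj X"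
  shows "\<sigma> A B \<in> Arr X" "src X (\<sigma> A B) = A \<odot> B" "tgt X (\<sigma> A B) = B \<odot> A"
  using symmetry_hom[OF assms] by (auto simp: hom_iff)

lemma interchange:
  assumes "f \<in> Arr X" "g \<in> Arr X" "h \<in> Arr X" "k \<in> Arr X" "tgt X f = src X g" "tgt X h = src X k"
  shows "(f \<otimes> h) \<cdot> (g \<otimes> k) = (f \<cdot> g) \<otimes> (h \<cdot> k)"
  by (rule tensor_comp[symmetric, of _ "src X f" "src X g" _ "tgt X g" _ "src X h" "src X k" _ "tgt X k"])
    (use assms in \<open>auto simp: hom_iff\<close>)

lemma interchange_assoc:
  assumes "f \<in> Arr X" "g \<in> Arr X" "h \<in> Arr X" "k \<in> Arr X" "tgt X f = src X g" "tgt X h = src X k"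
    and "r \<in> Arr X" "src X r = tgt X g \<odot> tgt X k"
  shows "(f \<otimes> h) \<cdot> ((g \<otimes> k) \<cdot> r) = ((f \<cdot> g) \<otimes> (h \<cdot> k)) \<cdot> r"
  using assms by (intro comp_rewrite interchange) auto

lemma symmetry_nat:
  assumes "f \<in> Arr X" "g \<in> Arr X"
  shows "\<sigma> (src X f) (src X g) \<cdot> (g \<otimes> f) = (f \<otimes> g) \<cdot> \<sigma> (tgt X f) (tgt X g)"
  by (rule symmetry_natural[symmetric]) (use assms in \<open>auto simp: hom_iff\<close>)

text \<open>The hexagon with two unit objects makes \<open>\<sigma> A \<K>\<close> idempotent. An
  invertible idempotent is an identity.\<close>

lemma symmetry_unit [simp]:
  assumes A: "A \<in> Obj X"
  shows "\<sigma> A \<K> = \<one> A" "\<sigma> \<K> A = \<one> A"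
proof -
  have idem: "\<sigma> A \<K> = \<sigma> A \<K> \<cdot> \<sigma> A \<K>"
    using symmetry_hexagon[of A \<K> \<K>] A by simp
  have inv: "\<sigma> A \<K> \<cdot> \<sigma> \<K> A = \<one> A"
    using symmetry_involutive[of A \<K>] A by simp
  have "\<sigma> A \<K> = \<sigma> A \<K> \<cdot> (\<sigma> A \<K> \<cdot> \<sigma> \<K> A)"
    using A inv by simp
  also have "\<dots> = (\<sigma> A \<K> \<cdot> \<sigma> A \<K>) \<cdot> \<sigma> \<K> A"
    using A by simp
  also have "\<dots> = \<one> A"
    using idem inv by simp
  finally show *: "\<sigma> A \<K> = \<one> A" .
  show "\<sigma> \<K> A = \<one> A"
    using inv A unfolding * by simp
qed

text \<open>Rebracketing isolates the two middle factors, where naturality of \<sigma> applies. It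
  serves to carry four copies of \<delta> past the swap in the bialgebra law.\<close>

lemma middle_swap_natural:
  assumes "a \<in> Arr X" "b \<in> Arr X" "c \<in> Arr X" "d \<in> Arr X"
  shows "((a \<otimes> b) \<otimes> (c \<otimes> d)) \<cdot> (\<one> (tgt X a) \<otimes> \<sigma> (tgt X b) (tgt X c) \<otimes> \<one> (tgt X d))
    = (\<one> (src X a) \<otimes> \<sigma> (src X b) (src X c) \<otimes> \<one> (src X d)) \<cdot> ((a \<otimes> c) \<otimes> (b \<otimes> d))"
proof -
  have "((a \<otimes> b) \<otimes> (c \<otimes> d)) \<cdot> (\<one> (tgt X a) \<otimes> \<sigma> (tgt X b) (tgt X c) \<otimes> \<one> (tgt X d))
      = (a \<otimes> ((b \<otimes> c) \<otimes> d)) \<cdot> (\<one> (tgt X a) \<otimes> (\<sigma> (tgt X b) (tgt X c) \<otimes> \<one> (tgt X d)))"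
    using assms by simp
  also have "\<dots> = a \<otimes> (((b \<otimes> c) \<cdot> \<sigma> (tgt X b) (tgt X c)) \<otimes> d)"
    using assms by (simp add: interchange del: tensor_arr_assoc)
  also have "\<dots> = a \<otimes> ((\<sigma> (src X b) (src X c) \<cdot> (c \<otimes> b)) \<otimes> d)"
    using assms by (simp add: symmetry_nat)
  also have "\<dots> = (\<one> (src X a) \<otimes> (\<sigma> (src X b) (src X c) \<otimes> \<one> (src X d))) \<cdot> (a \<otimes> ((c \<otimes> b) \<otimes> d))"
    using assms by (simp add: interchange del: tensor_arr_assoc)
  finally show ?thesis
    using assms by simp
qed

end

section \<open>Sums and zero arrows\<close>

context additive_symmetric_monoidal_category
begin

lemma add_simps [simp]:
  assumes "f \<in> Arr X" "g \<in> Arr X" "src X f = src X g" "tgt X f = tgt X g"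
  shows "f \<oplus> g \<in> Arr X" "src X (f \<oplus> g) = src X g" "tgt X (f \<oplus> g) = tgt X g"
  using add_hom[of f "src X g" "tgt X g" g] assms by (auto simp: hom_iff)

lemma zero_simps [simp]:
  assumes "A \<in> Obj X" "B \<in> Obj X"
  shows "\<zero> A B \<in> Arr X" "src X (\<zero> A B) = A" "tgt X (\<zero> A B) = B"
  using zero_hom[OF assms] by (auto simp: hom_iff)

lemma add_assoc_arr:
  assumes "f \<in> Arr X" "g \<in> Arr X" "h \<in> Arr X"
    and "src X f = src X h" "src X g = src X h" "tgt X f = tgt X h" "tgt X g = tgt X h"
  shows "(f \<oplus> g) \<oplus> h = f \<oplus> (g \<oplus> h)"
  by (rule add_assoc) (use assms in \<open>auto simp: hom_iff\<close>)

lemma add_commute_arr: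
  assumes "f \<in> Arr X" "g \<in> Arr X" "src X f = src X g" "tgt X f = tgt X g"
  shows "f \<oplus> g = g \<oplus> f"
  by (rule add_commute) (use assms in \<open>auto simp: hom_iff\<close>)

lemma add_zero_simps [simp]:
  assumes "f \<in> Arr X" "src X f = A" "tgt X f = B"
  shows "f \<oplus> \<zero> A B = f" "\<zero> A B \<oplus> f = f"
proof -
  show *: "f \<oplus> \<zero> A B = f"
    using assms by (intro add_zero) (auto simp: hom_iff)
  have "\<zero> A B \<oplus> f = f \<oplus> \<zero> A B"
    by (rule add_commute_arr) (use assms in auto)
  with * show "\<zero> A B \<oplus> f = f"
    by simp
qed

lemma distrib_simps [simp]:
  assumes "f \<in> Arr X" "g \<in> Arr X" "src X f = src X g" "tgt X f = tgt X g" "h \<in> Arr X"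
  shows "tgt X g = src X h \<Longrightarrow> (f \<oplus> g) \<cdot> h = f \<cdot> h \<oplus> g \<cdot> h"
    and "tgt X h = src X g \<Longrightarrow> h \<cdot> (f \<oplus> g) = h \<cdot> f \<oplus> h \<cdot> g"
    and "(f \<oplus> g) \<otimes> h = f \<otimes> h \<oplus> g \<otimes> h"
    and "h \<otimes> (f \<oplus> g) = h \<otimes> f \<oplus> h \<otimes> g"
  using assms comp_add_left[of f "src X g" "tgt X g" g h "tgt X h"]
    comp_add_right[of h "src X h" "src X g" f "tgt X g" g]
    tensor_add_left[of f "src X g" "tgt X g" g h "src X h" "tgt X h"]
    tensor_add_right[of h "src X h" "tgt X h" f "src X g" "tgt X g" g]
  by (auto simp: hom_iff)

lemma zero_absorb_simps [simp]:
  assumes "f \<in> Arr X" "A \<in> Obj X"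
  shows "src X f = B \<Longrightarrow> \<zero> A B \<cdot> f = \<zero> A (tgt X f)"
    and "tgt X f = B \<Longrightarrow> f \<cdot> \<zero> B A = \<zero> (src X f) A"
    and "B \<in> Obj X \<Longrightarrow> \<zero> A B \<otimes> f = \<zero> (A \<odot> src X f) (B \<odot> tgt X f)"
    and "B \<in> Obj X \<Longrightarrow> f \<otimes> \<zero> A B = \<zero> (src X f \<odot> A) (tgt X f \<odot> B)"
  using assms comp_zero_left[of A f "src X f" "tgt X f"] comp_zero_right[of f "src X f" "tgt X f" A]
    tensor_zero_left[of A B f "src X f" "tgt X f"] tensor_zero_right[of f "src X f" "tgt X f" A B]
  by (auto simp: hom_iff)

end

section \<open>Components of the modality and their naturality\<close>

context monoidal_coalgebra_modality
begin

lemma bo_Obj [simp]: "A \<in> Obj X \<Longrightarrow> bo A \<in> Obj X"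
  by (fact Fo_Obj)

lemma ba_simps [simp]:
  assumes "f \<in> Arr X"
  shows "ba f \<in> Arr X" "src X (ba f) = bo (src X f)" "tgt X (ba f) = bo (tgt X f)"
  using Fa_hom[of f "src X f" "tgt X f"] assms by (auto simp: hom_iff)

lemma ba_comp:
  "\<lbrakk>f \<in> Arr X; g \<in> Arr X; tgt X f = src X g\<rbrakk> \<Longrightarrow> ba (f \<cdot> g) = ba f \<cdot> ba g"
  by (rule Fa_comp) (auto simp: hom_iff)

lemma component_simps [simp]:
  assumes A: "A \<in> Obj X"
  shows "\<delta> A \<in> Arr X" "src X (\<delta> A) = bo A" "tgt X (\<delta> A) = bo (bo A)"
    and "\<epsilon> A \<in> Arr X" "src X (\<epsilon> A) = bo A" "tgt X (\<epsilon> A) = A"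
    and "\<Delta> A \<in> Arr X" "src X (\<Delta> A) = bo A" "tgt X (\<Delta> A) = bo A \<odot> bo A"
    and "e A \<in> Arr X" "src X (e A) = bo A" "tgt X (e A) = \<K>"
  using \<delta>.component_hom[OF A] \<epsilon>.component_hom[OF A] \<Delta>.component_hom[OF A] e.component_hom[OF A]
  by (auto simp: hom_iff)

lemma m_simps [simp]:
  assumes "A \<in> Obj X" "B \<in> Obj X"
  shows "m A B \<in> Arr X" "src X (m A B) = bo A \<odot> bo B" "tgt X (m A B) = bo (A \<odot> B)"
  using m_hom[OF assms] by (auto simp: hom_iff)

lemma mK_simps [simp]:
  "m\<^sub>K \<in> Arr X" "src X m\<^sub>K = \<K>" "tgt X m\<^sub>K = bo \<K>"
  using mK_hom by (auto simp: hom_iff)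

lemma naturality_simps:
  assumes "f \<in> Arr X"
  shows "ba f \<cdot> \<delta> (tgt X f) = \<delta> (src X f) \<cdot> ba (ba f)"
    and "ba f \<cdot> \<epsilon> (tgt X f) = \<epsilon> (src X f) \<cdot> f"
    and "ba f \<cdot> \<Delta> (tgt X f) = \<Delta> (src X f) \<cdot> (ba f \<otimes> ba f)"
    and "ba f \<cdot> e (tgt X f) = e (src X f)"
proof -
  have f: "f \<in> hom X (src X f) (tgt X f)"
    using assms by (simp add: hom_iff)
  show "ba f \<cdot> \<delta> (tgt X f) = \<delta> (src X f) \<cdot> ba (ba f)"
    "ba f \<cdot> \<epsilon> (tgt X f) = \<epsilon> (src X f) \<cdot> f"
    "ba f \<cdot> \<Delta> (tgt X f) = \<Delta> (src X f) \<cdot> (ba f \<otimes> ba f)"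
    using \<delta>.naturality[OF f] \<epsilon>.naturality[OF f] \<Delta>.naturality[OF f] by auto
  show "ba f \<cdot> e (tgt X f) = e (src X f)"
    using e.naturality[OF f] assms by simp
qed

lemma m_natural_arr:
  assumes "f \<in> Arr X" "g \<in> Arr X"
  shows "(ba f \<otimes> ba g) \<cdot> m (tgt X f) (tgt X g) = m (src X f) (src X g) \<cdot> ba (f \<otimes> g)"
  by (rule m_natural) (use assms in \<open>auto simp: hom_iff\<close>)

text \<open>The axioms relate \<delta> to \<Delta> explicitly; for \<open>e\<close> the relation is
  derived. Naturality along \<open>\<epsilon> A\<close> turns \<open>e (bo A)\<close> into
  \<open>ba (\<epsilon> A) \<cdot> e A\<close>, and the counit law cancels \<delta> against
  \<open>ba (\<epsilon> A)\<close>.\<close>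

lemma \<delta>_e:
  assumes A: "A \<in> Obj X"
  shows "\<delta> A \<cdot> e (bo A) = e A"
proof -
  have "\<delta> A \<cdot> e (bo A) = \<delta> A \<cdot> (ba (\<epsilon> A) \<cdot> e A)"
    using naturality_simps(4)[of "\<epsilon> A"] A by simp
  also have "\<dots> = \<one> (bo A) \<cdot> e A"
    using A by (intro comp_rewrite counit_right) auto
  finally show ?thesis
    using A by simp
qed

section \<open>Coalgebras of the comonad and their tensor product\<close>

definition coalgebra :: "'a \<Rightarrow> bool"
  where "coalgebra c \<longleftrightarrow> c \<in> Arr X \<and> tgt X c = bo (src X c)
    \<and> c \<cdot> \<epsilon> (src X c) = \<one> (src X c) \<and> c \<cdot> \<delta> (src X c) = c \<cdot> ba c"

text \<open>A coalgebra is represented by its structure map alone, its carrier being the source.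
  That \<open>c\<close> and \<open>d\<close> are coalgebras is not built in and is assumed
  separately where it matters.\<close>

definition coalgebra_hom :: "'a \<Rightarrow> 'a \<Rightarrow> 'a \<Rightarrow> bool"
  where "coalgebra_hom c d f \<longleftrightarrow> f \<in> Arr X \<and> src X f = src X c \<and> tgt X f = src X d
    \<and> f \<cdot> d = c \<cdot> ba f"

text \<open>The monoidal product of the Eilenberg-Moore category of a monoidal comonad; its unit is
  \<open>m\<^sub>K\<close>.\<close>

definition coalgebra_tensor :: "'a \<Rightarrow> 'a \<Rightarrow> 'a"  (infixl "\<boxtimes>" 75)
  where "c \<boxtimes> d = (c \<otimes> d) \<cdot> m (src X c) (src X d)"

lemma coalgebra_simps [simp]:
  assumes "coalgebra c"
  shows "c \<in> Arr X" "tgt X c = bo (src X c)"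
  using assms by (simp_all only: coalgebra_def)

lemma coalgebra_counit: "coalgebra c \<Longrightarrow> c \<cdot> \<epsilon> (src X c) = \<one> (src X c)"
  and coalgebra_coassoc: "coalgebra c \<Longrightarrow> c \<cdot> \<delta> (src X c) = c \<cdot> ba c"
  by (simp_all only: coalgebra_def)

lemma coalgebraI:
  assumes "c \<in> Arr X" "tgt X c = bo (src X c)"
    and "c \<cdot> \<epsilon> (src X c) = \<one> (src X c)" "c \<cdot> \<delta> (src X c) = c \<cdot> ba c"
  shows "coalgebra c"
  using assms by (simp only: coalgebra_def)

lemma coalgebra_tensor_simps [simp]:
  assumes "coalgebra c" "coalgebra d"
  shows "c \<boxtimes> d \<in> Arr X" "src X (c \<boxtimes> d) = src X c \<odot> src X d"
    "tgt X (c \<boxtimes> d) = bo (src X c \<odot> src X d)"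
  using assms by (auto simp: coalgebra_tensor_def)

lemma coalgebra_\<delta> [simp]: "A \<in> Obj X \<Longrightarrow> coalgebra (\<delta> A)"
  by (intro coalgebraI) (simp_all add: counit_left coassoc)

lemma coalgebra_mK [simp]: "coalgebra m\<^sub>K"
  by (intro coalgebraI) (simp_all add: mK_\<epsilon> mK_\<delta>)

text \<open>The counit law comes from monoidality of \<epsilon>, the coassociativity law from
  monoidality of \<delta> and naturality of \<open>m\<close>; each reduces to the same law for
  \<open>c\<close> and \<open>d\<close>.\<close>

lemma coalgebra_tensor [simp]:
  assumes c: "coalgebra c" and d: "coalgebra d"
  shows "coalgebra (c \<boxtimes> d)"
proof -
  let ?A = "src X c" and ?B = "src X d"
  have "(c \<boxtimes> d) \<cdot> \<epsilon> (?A \<odot> ?B) = (c \<otimes> d) \<cdot> (\<epsilon> ?A \<otimes> \<epsilon> ?B)"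
    using c d by (simp add: coalgebra_tensor_def m_\<epsilon>)
  also have "\<dots> = \<one> (?A \<odot> ?B)"
    using c d by (simp add: coalgebra_counit interchange)
  finally have counit: "(c \<boxtimes> d) \<cdot> \<epsilon> (?A \<odot> ?B) = \<one> (?A \<odot> ?B)" .
  have "(c \<boxtimes> d) \<cdot> \<delta> (?A \<odot> ?B)
      = (c \<otimes> d) \<cdot> ((\<delta> ?A \<otimes> \<delta> ?B) \<cdot> (m (bo ?A) (bo ?B) \<cdot> ba (m ?A ?B)))"
    using c d by (simp add: coalgebra_tensor_def m_\<delta>)
  also have "\<dots> = ((c \<cdot> \<delta> ?A) \<otimes> (d \<cdot> \<delta> ?B)) \<cdot> (m (bo ?A) (bo ?B) \<cdot> ba (m ?A ?B))"
    using c d by (simp add: interchange_assoc)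
  also have "\<dots> = ((c \<cdot> ba c) \<otimes> (d \<cdot> ba d)) \<cdot> (m (bo ?A) (bo ?B) \<cdot> ba (m ?A ?B))"
    using c d by (simp add: coalgebra_coassoc)
  also have "\<dots> = (c \<otimes> d) \<cdot> ((ba c \<otimes> ba d) \<cdot> (m (bo ?A) (bo ?B) \<cdot> ba (m ?A ?B)))"
    using c d by (simp add: interchange_assoc)
  also have "(ba c \<otimes> ba d) \<cdot> (m (bo ?A) (bo ?B) \<cdot> ba (m ?A ?B))
      = (m ?A ?B \<cdot> ba (c \<otimes> d)) \<cdot> ba (m ?A ?B)"
    using c d m_natural_arr[of c d] by (intro comp_rewrite) auto
  also have "(c \<otimes> d) \<cdot> \<dots> = (c \<boxtimes> d) \<cdot> ba (c \<boxtimes> d)"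
    using c d by (simp add: coalgebra_tensor_def ba_comp)
  finally show ?thesis
    using c d counit by (intro coalgebraI) simp_all
qed

text \<open>Associativity of \<open>m\<close> gives a strict equality because the tensor is strict.
  It lets the two sides of associativity of \<nabla> count as morphisms out of one
  coalgebra.\<close>

lemma coalgebra_tensor_assoc:
  assumes "coalgebra c" "coalgebra d" "coalgebra k"
  shows "(c \<boxtimes> d) \<boxtimes> k = c \<boxtimes> (d \<boxtimes> k)"
proof -
  let ?A = "src X c" and ?B = "src X d" and ?C = "src X k"
  have "(c \<boxtimes> d) \<boxtimes> k = (((c \<otimes> d) \<otimes> k) \<cdot> (m ?A ?B \<otimes> \<one> (bo ?C))) \<cdot> m (?A \<odot> ?B) ?C"
    using assms by (simp add: coalgebra_tensor_def interchange del: tensor_arr_assoc comp_assoc_simp)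
  also have "\<dots> = (c \<otimes> (d \<otimes> k)) \<cdot> ((m ?A ?B \<otimes> \<one> (bo ?C)) \<cdot> m (?A \<odot> ?B) ?C)"
    using assms by simp
  also have "\<dots> = (c \<otimes> (d \<otimes> k)) \<cdot> ((\<one> (bo ?A) \<otimes> m ?B ?C) \<cdot> m ?A (?B \<odot> ?C))"
    using assms by (simp add: m_assoc)
  also have "\<dots> = c \<boxtimes> (d \<boxtimes> k)"
    using assms by (simp add: coalgebra_tensor_def interchange_assoc)
  finally show ?thesis .
qed

lemma coalgebra_tensor_unit:
  assumes "coalgebra c"
  shows "m\<^sub>K \<boxtimes> c = c" "c \<boxtimes> m\<^sub>K = c"
proof -
  let ?A = "src X c"
  \<comment> \<open>Padding with identities lets \<open>c\<close> act before
    \<open>m\<^sub>K\<close>, which exposes the unit law of \<open>m\<close>. The simp rule that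
    would erase the padding is switched off.\<close>
  have "m\<^sub>K \<boxtimes> c = ((\<one> \<K> \<otimes> c) \<cdot> (m\<^sub>K \<otimes> \<one> (bo ?A))) \<cdot> m \<K> ?A"
    using assms by (simp add: coalgebra_tensor_def interchange del: tensor_arr_unit_left)
  also have "\<dots> = c \<cdot> ((m\<^sub>K \<otimes> \<one> (bo ?A)) \<cdot> m \<K> ?A)"
    using assms by simp
  finally show "m\<^sub>K \<boxtimes> c = c"
    using assms by (simp add: m_unit_left)
  have "c \<boxtimes> m\<^sub>K = ((c \<otimes> \<one> \<K>) \<cdot> (\<one> (bo ?A) \<otimes> m\<^sub>K)) \<cdot> m ?A \<K>"
    using assms by (simp add: coalgebra_tensor_def interchange del: tensor_arr_unit_right)
  also have "\<dots> = c \<cdot> ((\<one> (bo ?A) \<otimes> m\<^sub>K) \<cdot> m ?A \<K>)"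
    using assms by simp
  finally show "c \<boxtimes> m\<^sub>K = c"
    using assms by (simp add: m_unit_right)
qed

section \<open>Coalgebra morphisms and the universal property of cofree coalgebras\<close>

lemma coalgebra_hom_simps:
  assumes "coalgebra_hom c d f"
  shows "f \<in> Arr X" "src X f = src X c" "tgt X f = src X d" "f \<cdot> d = c \<cdot> ba f"
  using assms by (auto simp: coalgebra_hom_def)

lemma coalgebra_hom_ident: "coalgebra c \<Longrightarrow> coalgebra_hom c c (\<one> (src X c))"
  by (simp add: coalgebra_hom_def Fa_ident)

lemma coalgebra_hom_comp:
  assumes c: "coalgebra c" and d: "coalgebra d" and k: "coalgebra k"
    and f: "coalgebra_hom c d f" and g: "coalgebra_hom d k g"
  shows "coalgebra_hom c k (f \<cdot> g)"
proof -
  note [simp] = coalgebra_hom_simps(1-3)[OF f] coalgebra_hom_simps(1-3)[OF g]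
  have "(f \<cdot> g) \<cdot> k = f \<cdot> (d \<cdot> ba g)"
    using c d k coalgebra_hom_simps(4)[OF g] by simp
  also have "\<dots> = (c \<cdot> ba f) \<cdot> ba g"
    using c d k coalgebra_hom_simps(4)[OF f] by (intro comp_rewrite) auto
  finally show ?thesis
    using c d k by (simp add: coalgebra_hom_def ba_comp)
qed

lemma coalgebra_hom_tensor:
  assumes c: "coalgebra c" "coalgebra c'" and d: "coalgebra d" "coalgebra d'"
    and f: "coalgebra_hom c c' f" and g: "coalgebra_hom d d' g"
  shows "coalgebra_hom (c \<boxtimes> d) (c' \<boxtimes> d') (f \<otimes> g)"
proof -
  note [simp] = coalgebra_hom_simps(1-3)[OF f] coalgebra_hom_simps(1-3)[OF g]
  have "(f \<otimes> g) \<cdot> (c' \<boxtimes> d') = ((f \<cdot> c') \<otimes> (g \<cdot> d')) \<cdot> m (src X c') (src X d')"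
    using c d by (simp add: coalgebra_tensor_def interchange_assoc)
  also have "\<dots> = ((c \<cdot> ba f) \<otimes> (d \<cdot> ba g)) \<cdot> m (src X c') (src X d')"
    using coalgebra_hom_simps(4)[OF f] coalgebra_hom_simps(4)[OF g] by simp
  also have "\<dots> = (c \<otimes> d) \<cdot> ((ba f \<otimes> ba g) \<cdot> m (src X c') (src X d'))"
    using c d by (simp add: interchange_assoc)
  also have "\<dots> = (c \<boxtimes> d) \<cdot> ba (f \<otimes> g)"
    using c d m_natural_arr[of f g] by (simp add: coalgebra_tensor_def)
  finally show ?thesis
    using c d by (simp add: coalgebra_hom_def)
qed

text \<open>Naturality of \<sigma> moves it past \<open>c \<otimes> d\<close>; symmetry of
  \<open>m\<close> then turns it into \<open>ba\<close> of \<sigma>.\<close>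

lemma coalgebra_hom_symmetry:
  assumes "coalgebra c" "coalgebra d"
  shows "coalgebra_hom (c \<boxtimes> d) (d \<boxtimes> c) (\<sigma> (src X c) (src X d))"
proof -
  let ?A = "src X c" and ?B = "src X d"
  have "\<sigma> ?A ?B \<cdot> (d \<boxtimes> c) = ((c \<otimes> d) \<cdot> \<sigma> (bo ?A) (bo ?B)) \<cdot> m ?B ?A"
    unfolding coalgebra_tensor_def
    using assms symmetry_nat[of c d] by (intro comp_rewrite) auto
  also have "\<dots> = (c \<boxtimes> d) \<cdot> ba (\<sigma> ?A ?B)"
    using assms m_symmetry[of ?A ?B] by (simp add: coalgebra_tensor_def)
  finally show ?thesis
    using assms by (simp add: coalgebra_hom_def)
qed

lemma coalgebra_hom_ba: "f \<in> Arr X \<Longrightarrow> coalgebra_hom (\<delta> (src X f)) (\<delta> (tgt X f)) (ba f)"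
  by (simp add: coalgebra_hom_def naturality_simps)

lemma coalgebra_hom_\<Delta>: "A \<in> Obj X \<Longrightarrow> coalgebra_hom (\<delta> A) (\<delta> A \<boxtimes> \<delta> A) (\<Delta> A)"
  by (simp add: coalgebra_hom_def coalgebra_tensor_def \<Delta>_coalgebra_morphism)

lemma coalgebra_hom_e: "A \<in> Obj X \<Longrightarrow> coalgebra_hom (\<delta> A) m\<^sub>K (e A)"
  by (simp add: coalgebra_hom_def e_coalgebra_morphism)

text \<open>Existence half of cofreeness. The morphism law follows from naturality of \<delta> and
  coassociativity of \<open>c\<close>, the value after \<epsilon> from naturality of \<epsilon> and
  the counit law of \<open>c\<close>.\<close>

lemma cofree_lift:
  assumes c: "coalgebra c" and h: "h \<in> Arr X" "src X h = src X c"
  shows "coalgebra_hom c (\<delta> (tgt X h)) (c \<cdot> ba h)" "(c \<cdot> ba h) \<cdot> \<epsilon> (tgt X h) = h"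
proof -
  have "(c \<cdot> ba h) \<cdot> \<delta> (tgt X h) = c \<cdot> (\<delta> (src X c) \<cdot> ba (ba h))"
    using c h naturality_simps(1)[of h] by simp
  also have "\<dots> = (c \<cdot> ba c) \<cdot> ba (ba h)"
    using c h by (intro comp_rewrite) (auto simp: coalgebra_coassoc)
  finally show "coalgebra_hom c (\<delta> (tgt X h)) (c \<cdot> ba h)"
    using c h by (simp add: coalgebra_hom_def ba_comp)
  have "(c \<cdot> ba h) \<cdot> \<epsilon> (tgt X h) = c \<cdot> (\<epsilon> (src X c) \<cdot> h)"
    using c h naturality_simps(2)[of h] by simp
  also have "\<dots> = \<one> (src X c) \<cdot> h"
    using c h by (intro comp_rewrite) (auto simp: coalgebra_counit)
  finally show "(c \<cdot> ba h) \<cdot> \<epsilon> (tgt X h) = h"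
    using h by simp
qed

text \<open>Uniqueness half of cofreeness. Inserting
  \<open>\<delta> A \<cdot> ba (\<epsilon> A)\<close>, an identity, after a morphism
  \<open>k\<close> and using the morphism law gives
  \<open>k = c \<cdot> ba (k \<cdot> \<epsilon> A)\<close>, so \<open>k\<close> is recovered from
  \<open>k \<cdot> \<epsilon> A\<close>.\<close>

lemma cofree_unique:
  assumes c: "coalgebra c" and A: "A \<in> Obj X"
    and f: "coalgebra_hom c (\<delta> A) f" and g: "coalgebra_hom c (\<delta> A) g"
    and eq: "f \<cdot> \<epsilon> A = g \<cdot> \<epsilon> A"
  shows "f = g"
proof -
  have *: "k = c \<cdot> ba (k \<cdot> \<epsilon> A)" if k: "coalgebra_hom c (\<delta> A) k" for k
  proof -
    note [simp] = coalgebra_hom_simps(1-3)[OF k]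
    have "k = k \<cdot> (\<delta> A \<cdot> ba (\<epsilon> A))"
      using A by (simp add: counit_right)
    also have "\<dots> = (c \<cdot> ba k) \<cdot> ba (\<epsilon> A)"
      using c A coalgebra_hom_simps(4)[OF k] by (intro comp_rewrite) auto
    finally show ?thesis
      using c A by (simp add: ba_comp)
  qed
  from *[OF f] *[OF g] eq show ?thesis
    by simp
qed

end

section \<open>Construction of \<nabla> and \<open>u\<close>, and their compatibility with the
  comonoid structure\<close>

context additive_linear_category
begin

definition mult :: "'o \<Rightarrow> 'a"
  where "mult A = (\<delta> A \<otimes> \<delta> A) \<cdot> m (bo A) (bo A) \<cdot> ba (\<epsilon> A \<otimes> e A \<oplus> e A \<otimes> \<epsilon> A)"

definition unit :: "'o \<Rightarrow> 'a"
  where "unit A = m\<^sub>K \<cdot> ba (\<zero> \<K> A)"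

lemma mult_eq: "A \<in> Obj X \<Longrightarrow> mult A = (\<delta> A \<boxtimes> \<delta> A) \<cdot> ba (\<epsilon> A \<otimes> e A \<oplus> e A \<otimes> \<epsilon> A)"
  by (simp add: mult_def coalgebra_tensor_def)

text \<open>Up to bracketing, \<open>mult A\<close> is the cofree lift of the displayed sum along
  \<open>\<delta> A \<boxtimes> \<delta> A\<close>, so both facts are instances of
  \<open>cofree_lift\<close>.\<close>

lemma coalgebra_hom_mult: "A \<in> Obj X \<Longrightarrow> coalgebra_hom (\<delta> A \<boxtimes> \<delta> A) (\<delta> A) (mult A)"
  and mult_\<epsilon>: "A \<in> Obj X \<Longrightarrow> mult A \<cdot> \<epsilon> A = \<epsilon> A \<otimes> e A \<oplus> e A \<otimes> \<epsilon> A"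
  using cofree_lift[of "\<delta> A \<boxtimes> \<delta> A" "\<epsilon> A \<otimes> e A \<oplus> e A \<otimes> \<epsilon> A"]
  by (simp_all add: mult_eq)

lemma coalgebra_hom_unit: "A \<in> Obj X \<Longrightarrow> coalgebra_hom m\<^sub>K (\<delta> A) (unit A)"
  and unit_\<epsilon>: "A \<in> Obj X \<Longrightarrow> unit A \<cdot> \<epsilon> A = \<zero> \<K> A"
  using cofree_lift[of m\<^sub>K "\<zero> \<K> A"]
  by (simp_all add: unit_def)

lemma mult_simps [simp]:
  assumes "A \<in> Obj X"
  shows "mult A \<in> Arr X" "src X (mult A) = bo A \<odot> bo A" "tgt X (mult A) = bo A"
  using coalgebra_hom_simps(1-3)[OF coalgebra_hom_mult[OF assms]] assms by auto

lemma unit_simps [simp]: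
  assumes "A \<in> Obj X"
  shows "unit A \<in> Arr X" "src X (unit A) = \<K>" "tgt X (unit A) = bo A"
  using coalgebra_hom_simps(1-3)[OF coalgebra_hom_unit[OF assms]] assms by auto

text \<open>The target is \<K> and not a cofree coalgebra, so \<open>e\<close> is instead pushed
  leftwards through the three factors of \<open>mult A\<close>: by naturality, by monoidality of
  \<open>e\<close>, and by \<open>\<delta>_e\<close>.\<close>

lemma mult_e:
  assumes A: "A \<in> Obj X"
  shows "mult A \<cdot> e A = e A \<otimes> e A"
proof -
  let ?h = "\<epsilon> A \<otimes> e A \<oplus> e A \<otimes> \<epsilon> A"
  have "mult A \<cdot> e A = (\<delta> A \<otimes> \<delta> A) \<cdot> (m (bo A) (bo A) \<cdot> (ba ?h \<cdot> e A))"
    using A by (simp add: mult_def del: distrib_simps)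
  also have "ba ?h \<cdot> e A = e (bo A \<odot> bo A)"
    using naturality_simps(4)[of ?h] A by (simp del: distrib_simps)
  also have "(\<delta> A \<otimes> \<delta> A) \<cdot> (m (bo A) (bo A) \<cdot> e (bo A \<odot> bo A)) = e A \<otimes> e A"
    using A by (simp add: m_e interchange \<delta>_e)
  finally show ?thesis .
qed

lemma unit_e:
  assumes A: "A \<in> Obj X"
  shows "unit A \<cdot> e A = \<one> \<K>"
  using naturality_simps(4)[of "\<zero> \<K> A"] A by (simp add: unit_def mK_e)

lemma unit_\<Delta>:
  assumes A: "A \<in> Obj X"
  shows "unit A \<cdot> \<Delta> A = unit A \<otimes> unit A"
proof -
  have "unit A \<cdot> \<Delta> A = m\<^sub>K \<cdot> (\<Delta> \<K> \<cdot> (ba (\<zero> \<K> A) \<otimes> ba (\<zero> \<K> A)))"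
    using naturality_simps(3)[of "\<zero> \<K> A"] A by (simp add: unit_def)
  also have "\<dots> = (m\<^sub>K \<otimes> m\<^sub>K) \<cdot> (ba (\<zero> \<K> A) \<otimes> ba (\<zero> \<K> A))"
    using A mK_\<Delta> by (intro comp_rewrite) auto
  finally show ?thesis
    using A by (simp add: unit_def interchange)
qed

text \<open>The uniqueness principle concerns maps into \<open>bo A\<close>, while this equation
  ends in \<open>bo A \<odot> bo A\<close>. So \<Delta> is carried leftwards through
  \<open>ba h\<close>, \<open>m\<close> and \<delta> in turn.\<close>

lemma mult_\<Delta>:
  assumes A: "A \<in> Obj X"
  shows "mult A \<cdot> \<Delta> A
    = (\<Delta> A \<otimes> \<Delta> A) \<cdot> (\<one> (bo A) \<otimes> \<sigma> (bo A) (bo A) \<otimes> \<one> (bo A)) \<cdot> (mult A \<otimes> mult A)"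
proof -
  \<comment> \<open>Naming the sum keeps it opaque to the distributivity rules; the calculation
    needs only its source and target.\<close>
  define h where "h = \<epsilon> A \<otimes> e A \<oplus> e A \<otimes> \<epsilon> A"
  have h [simp]: "h \<in> Arr X" "src X h = bo A \<odot> bo A" "tgt X h = A"
    using A by (auto simp: h_def)
  let ?B = "bo A" and ?C = "bo (bo A)"
  let ?s = "\<lambda>B. \<one> B \<otimes> \<sigma> B B \<otimes> \<one> B"
  have mult: "mult A = (\<delta> A \<otimes> \<delta> A) \<cdot> (m ?B ?B \<cdot> ba h)"
    using A by (simp add: mult_def h_def del: distrib_simps)
  have "mult A \<cdot> \<Delta> A = (\<delta> A \<otimes> \<delta> A) \<cdot> (m ?B ?B \<cdot> (\<Delta> (?B \<odot> ?B) \<cdot> (ba h \<otimes> ba h)))"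
    using A naturality_simps(3)[of h] by (simp add: mult)
  also have "m ?B ?B \<cdot> (\<Delta> (?B \<odot> ?B) \<cdot> (ba h \<otimes> ba h))
      = ((\<Delta> ?B \<otimes> \<Delta> ?B) \<cdot> ?s ?C \<cdot> (m ?B ?B \<otimes> m ?B ?B)) \<cdot> (ba h \<otimes> ba h)"
    using A m_\<Delta>[of ?B ?B] by (intro comp_rewrite) auto
  also have "\<dots> = (\<Delta> ?B \<otimes> \<Delta> ?B) \<cdot> (?s ?C \<cdot> ((m ?B ?B \<cdot> ba h) \<otimes> (m ?B ?B \<cdot> ba h)))"
    using A by (simp add: interchange)
  \<comment> \<open>In each tensor factor \<delta> preserves comultiplication:
    \<open>\<delta>_\<Delta>\<close> moves \<Delta> in front.\<close>
  also have "(\<delta> A \<otimes> \<delta> A) \<cdot> \<dots>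
      = ((\<Delta> A \<cdot> (\<delta> A \<otimes> \<delta> A)) \<otimes> (\<Delta> A \<cdot> (\<delta> A \<otimes> \<delta> A))) \<cdot>
        (?s ?C \<cdot> ((m ?B ?B \<cdot> ba h) \<otimes> (m ?B ?B \<cdot> ba h)))"
    using A \<delta>_\<Delta>[of A] by (simp add: interchange_assoc)
  also have "\<dots> = (\<Delta> A \<otimes> \<Delta> A) \<cdot> (((\<delta> A \<otimes> \<delta> A) \<otimes> (\<delta> A \<otimes> \<delta> A)) \<cdot>
        (?s ?C \<cdot> ((m ?B ?B \<cdot> ba h) \<otimes> (m ?B ?B \<cdot> ba h))))"
    using A by (simp add: interchange_assoc del: tensor_arr_assoc)
  \<comment> \<open>The four copies of \<delta> pass the middle swap, where they rejoin
    \<open>m\<close> and \<open>ba h\<close> to form two copies of \<open>mult A\<close>.\<close>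
  also have "((\<delta> A \<otimes> \<delta> A) \<otimes> (\<delta> A \<otimes> \<delta> A)) \<cdot>
        (?s ?C \<cdot> ((m ?B ?B \<cdot> ba h) \<otimes> (m ?B ?B \<cdot> ba h)))
      = (?s ?B \<cdot> ((\<delta> A \<otimes> \<delta> A) \<otimes> (\<delta> A \<otimes> \<delta> A))) \<cdot>
        ((m ?B ?B \<cdot> ba h) \<otimes> (m ?B ?B \<cdot> ba h))"
    using A middle_swap_natural[of "\<delta> A" "\<delta> A" "\<delta> A" "\<delta> A"]
    by (intro comp_rewrite) auto
  also have "\<dots> = ?s ?B \<cdot> (mult A \<otimes> mult A)"
    using A by (simp add: mult interchange del: tensor_arr_assoc)
  finally show ?thesis
    using A by simp
qed

section \<open>Naturality of \<nabla> and the commutative monoid laws\<close>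

lemma mult_natural:
  assumes f: "f \<in> Arr X"
  shows "(ba f \<otimes> ba f) \<cdot> mult (tgt X f) = mult (src X f) \<cdot> ba f"
proof -
  let ?A = "src X f" and ?B = "tgt X f"
  note AB = src_tgt_Obj[OF f]
  \<comment> \<open>Both sides are coalgebra morphisms into \<open>\<delta> ?B\<close>, so they are
    compared after \<epsilon>.\<close>
  have "((ba f \<otimes> ba f) \<cdot> mult ?B) \<cdot> \<epsilon> ?B = (\<epsilon> ?A \<cdot> f) \<otimes> e ?A \<oplus> e ?A \<otimes> (\<epsilon> ?A \<cdot> f)"
    using f by (simp add: mult_\<epsilon> interchange naturality_simps)
  \<comment> \<open>By strictness \<open>f\<close> equals both
    \<open>f \<otimes> \<one> \<K>\<close> and \<open>\<one> \<K> \<otimes> f\<close>; with this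
    padding it factors out of both summands.\<close>
  also have "\<dots> = (\<epsilon> ?A \<otimes> e ?A) \<cdot> (f \<otimes> \<one> \<K>) \<oplus> (e ?A \<otimes> \<epsilon> ?A) \<cdot> (\<one> \<K> \<otimes> f)"
    using f by (simp add: interchange del: tensor_arr_unit_left tensor_arr_unit_right)
  also have "\<dots> = (\<epsilon> ?A \<otimes> e ?A \<oplus> e ?A \<otimes> \<epsilon> ?A) \<cdot> f"
    using f by simp
  also have "\<dots> = mult ?A \<cdot> (\<epsilon> ?A \<cdot> f)"
    unfolding mult_\<epsilon>[OF AB(1), symmetric] using f by simp
  also have "\<dots> = (mult ?A \<cdot> ba f) \<cdot> \<epsilon> ?B"
    using f by (simp add: naturality_simps)
  finally have "((ba f \<otimes> ba f) \<cdot> mult ?B) \<cdot> \<epsilon> ?B = (mult ?A \<cdot> ba f) \<cdot> \<epsilon> ?B" .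
  moreover have "coalgebra_hom (\<delta> ?A \<boxtimes> \<delta> ?A) (\<delta> ?B) ((ba f \<otimes> ba f) \<cdot> mult ?B)"
    using f by (intro coalgebra_hom_comp[of _ "\<delta> ?B \<boxtimes> \<delta> ?B"] coalgebra_hom_tensor
        coalgebra_hom_mult coalgebra_hom_ba) auto
  moreover have "coalgebra_hom (\<delta> ?A \<boxtimes> \<delta> ?A) (\<delta> ?B) (mult ?A \<cdot> ba f)"
    using f by (intro coalgebra_hom_comp[of _ "\<delta> ?A"] coalgebra_hom_mult coalgebra_hom_ba) auto
  ultimately show ?thesis
    using f by - (rule cofree_unique[of "\<delta> ?A \<boxtimes> \<delta> ?A" ?B], auto)
qed

text \<open>After \<epsilon>, and using \<open>mult_e\<close>, each side is the sum of the three
  terms with \<epsilon> in one factor and \<open>e\<close> in the other two; only the bracketing of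
  the sum differs.\<close>

lemma mult_assoc:
  assumes A: "A \<in> Obj X"
  shows "(mult A \<otimes> \<one> (bo A)) \<cdot> mult A = (\<one> (bo A) \<otimes> mult A) \<cdot> mult A"
proof -
  let ?c = "\<delta> A"
  have id: "coalgebra_hom ?c ?c (\<one> (bo A))"
    using coalgebra_hom_ident[of ?c] A by simp
  have "((mult A \<otimes> \<one> (bo A)) \<cdot> mult A) \<cdot> \<epsilon> A = ((\<one> (bo A) \<otimes> mult A) \<cdot> mult A) \<cdot> \<epsilon> A"
    using A by (simp add: mult_\<epsilon> interchange mult_e add_assoc_arr)
  moreover have "coalgebra_hom ((?c \<boxtimes> ?c) \<boxtimes> ?c) ?c ((mult A \<otimes> \<one> (bo A)) \<cdot> mult A)"
    using A by (intro coalgebra_hom_comp[of _ "?c \<boxtimes> ?c"] coalgebra_hom_tensor coalgebra_hom_mult id) auto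
  moreover have "coalgebra_hom (?c \<boxtimes> (?c \<boxtimes> ?c)) ?c ((\<one> (bo A) \<otimes> mult A) \<cdot> mult A)"
    using A by (intro coalgebra_hom_comp[of _ "?c \<boxtimes> ?c"] coalgebra_hom_tensor coalgebra_hom_mult id) auto
  ultimately show ?thesis
    using A by - (rule cofree_unique[of "?c \<boxtimes> (?c \<boxtimes> ?c)" A], auto simp: coalgebra_tensor_assoc)
qed

text \<open>After \<epsilon>, precomposing with \<sigma> exchanges the two summands.\<close>

lemma mult_comm:
  assumes A: "A \<in> Obj X"
  shows "\<sigma> (bo A) (bo A) \<cdot> mult A = mult A"
proof -
  let ?c = "\<delta> A"
  have "(\<sigma> (bo A) (bo A) \<cdot> mult A) \<cdot> \<epsilon> A = mult A \<cdot> \<epsilon> A"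
    using A symmetry_nat[of "e A" "\<epsilon> A"] symmetry_nat[of "\<epsilon> A" "e A"]
      add_commute_arr[of "\<epsilon> A \<otimes> e A" "e A \<otimes> \<epsilon> A"]
    by (simp add: mult_\<epsilon>)
  moreover have "coalgebra_hom (?c \<boxtimes> ?c) ?c (\<sigma> (bo A) (bo A) \<cdot> mult A)"
    using A coalgebra_hom_symmetry[of ?c ?c]
    by (intro coalgebra_hom_comp[of _ "?c \<boxtimes> ?c"] coalgebra_hom_mult) auto
  ultimately show ?thesis
    using A by - (rule cofree_unique[of "?c \<boxtimes> ?c" A], auto intro: coalgebra_hom_mult)
qed

text \<open>After \<epsilon>, one summand contains \<open>unit A \<cdot> \<epsilon> A\<close>, which
  is zero, and in the other \<open>unit A \<cdot> e A\<close> is an identity, leaving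
  \<open>\<epsilon> A\<close>. The identity is itself a coalgebra morphism, and tensoring with
  \<open>m\<^sub>K\<close> does not change the source coalgebra.\<close>

lemma mult_unit:
  assumes A: "A \<in> Obj X"
  shows "(unit A \<otimes> \<one> (bo A)) \<cdot> mult A = \<one> (bo A)" "(\<one> (bo A) \<otimes> unit A) \<cdot> mult A = \<one> (bo A)"
proof -
  let ?c = "\<delta> A"
  have id: "coalgebra_hom ?c ?c (\<one> (bo A))"
    using coalgebra_hom_ident[of ?c] A by simp
  have "((unit A \<otimes> \<one> (bo A)) \<cdot> mult A) \<cdot> \<epsilon> A = \<one> (bo A) \<cdot> \<epsilon> A"
    using A by (simp add: mult_\<epsilon> interchange unit_\<epsilon> unit_e)
  moreover have "coalgebra_hom (m\<^sub>K \<boxtimes> ?c) ?c ((unit A \<otimes> \<one> (bo A)) \<cdot> mult A)"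
    using A by (intro coalgebra_hom_comp[of _ "?c \<boxtimes> ?c"] coalgebra_hom_tensor coalgebra_hom_mult
        coalgebra_hom_unit id) auto
  ultimately show "(unit A \<otimes> \<one> (bo A)) \<cdot> mult A = \<one> (bo A)"
    using A id by - (rule cofree_unique[of ?c A], auto simp: coalgebra_tensor_unit)
  have "((\<one> (bo A) \<otimes> unit A) \<cdot> mult A) \<cdot> \<epsilon> A = \<one> (bo A) \<cdot> \<epsilon> A"
    using A by (simp add: mult_\<epsilon> interchange unit_\<epsilon> unit_e)
  moreover have "coalgebra_hom (?c \<boxtimes> m\<^sub>K) ?c ((\<one> (bo A) \<otimes> unit A) \<cdot> mult A)"
    using A by (intro coalgebra_hom_comp[of _ "?c \<boxtimes> ?c"] coalgebra_hom_tensor coalgebra_hom_mult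
        coalgebra_hom_unit id) auto
  ultimately show "(\<one> (bo A) \<otimes> unit A) \<cdot> mult A = \<one> (bo A)"
    using A id by - (rule cofree_unique[of ?c A], auto simp: coalgebra_tensor_unit)
qed

section \<open>Naturality of \<open>u\<close>, and the action of ! on zero maps and sums\<close>

lemma unit_natural:
  assumes "f \<in> Arr X"
  shows "unit (tgt X f) = unit (src X f) \<cdot> ba f"
  using assms by (simp add: unit_def flip: ba_comp)

text \<open>Both sides are coalgebra morphisms from \<open>\<delta> A\<close> to
  \<open>\<delta> B\<close> that become zero after \<epsilon>.\<close>

lemma ba_zero:
  assumes A: "A \<in> Obj X" and B: "B \<in> Obj X"
  shows "ba (\<zero> A B) = e A \<cdot> unit B"
proof -
  have "(e A \<cdot> unit B) \<cdot> \<epsilon> B = ba (\<zero> A B) \<cdot> \<epsilon> B"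
    using A B naturality_simps(2)[of "\<zero> A B"] by (simp add: unit_\<epsilon>)
  moreover have "coalgebra_hom (\<delta> A) (\<delta> B) (e A \<cdot> unit B)"
    using A B by (intro coalgebra_hom_comp[of _ m\<^sub>K] coalgebra_hom_e coalgebra_hom_unit) auto
  ultimately show ?thesis
    using A B coalgebra_hom_ba[of "\<zero> A B"] by - (rule cofree_unique[of "\<delta> A" B], auto)
qed

text \<open>Both sides are coalgebra morphisms from \<open>\<delta> A\<close> to
  \<open>\<delta> B\<close>. After \<epsilon>, the comonoid counit laws reduce the convolution on
  the right to \<open>\<epsilon> A \<cdot> f \<oplus> \<epsilon> A \<cdot> g\<close>, which is
  \<epsilon> followed by the sum.\<close>

lemma ba_add:
  assumes f: "f \<in> Arr X" and g: "g \<in> Arr X"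
    and [simp]: "src X f = A" "tgt X f = B" "src X g = A" "tgt X g = B"
  shows "ba (f \<oplus> g) = \<Delta> A \<cdot> (ba f \<otimes> ba g) \<cdot> mult B"
proof -
  have A [simp]: "A \<in> Obj X" and B [simp]: "B \<in> Obj X"
    using src_tgt_Obj[OF f] by auto
  interpret cocommutative_comonoid X "bo A" "\<Delta> A" "e A"
    using A by (rule comonoid)
  have nat: "ba k \<cdot> \<epsilon> B = \<epsilon> A \<cdot> k" "ba k \<cdot> e B = e A"
    if "k \<in> Arr X" "src X k = A" "tgt X k = B" for k
    using naturality_simps(2,4)[of k] that by auto
  have "(\<Delta> A \<cdot> (ba f \<otimes> ba g) \<cdot> mult B) \<cdot> \<epsilon> B
      = \<Delta> A \<cdot> ((\<epsilon> A \<cdot> f) \<otimes> e A) \<oplus> \<Delta> A \<cdot> (e A \<otimes> (\<epsilon> A \<cdot> g))"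
    using f g by (simp add: mult_\<epsilon> interchange nat)
  \<comment> \<open>Each summand is split so that \<open>e A\<close> acts first, directly after
    \<Delta>, where a counit law removes it.\<close>
  also have "(\<epsilon> A \<cdot> f) \<otimes> e A = (\<one> (bo A) \<otimes> e A) \<cdot> ((\<epsilon> A \<cdot> f) \<otimes> \<one> \<K>)"
    using f by (simp add: interchange del: tensor_arr_unit_left tensor_arr_unit_right)
  also have "e A \<otimes> (\<epsilon> A \<cdot> g) = (e A \<otimes> \<one> (bo A)) \<cdot> (\<one> \<K> \<otimes> (\<epsilon> A \<cdot> g))"
    using g by (simp add: interchange del: tensor_arr_unit_left tensor_arr_unit_right)
  also have "\<Delta> A \<cdot> ((\<one> (bo A) \<otimes> e A) \<cdot> ((\<epsilon> A \<cdot> f) \<otimes> \<one> \<K>)) = \<one> (bo A) \<cdot> (\<epsilon> A \<cdot> f)"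
    using f comp_rewrite[OF comult_counit_right, of "\<epsilon> A \<cdot> f"] by simp
  also have "\<Delta> A \<cdot> ((e A \<otimes> \<one> (bo A)) \<cdot> (\<one> \<K> \<otimes> (\<epsilon> A \<cdot> g))) = \<one> (bo A) \<cdot> (\<epsilon> A \<cdot> g)"
    using g comp_rewrite[OF comult_counit_left, of "\<epsilon> A \<cdot> g"] by simp
  also have "\<one> (bo A) \<cdot> (\<epsilon> A \<cdot> f) \<oplus> \<one> (bo A) \<cdot> (\<epsilon> A \<cdot> g) = ba (f \<oplus> g) \<cdot> \<epsilon> B"
    using f g by (simp add: nat)
  finally have "ba (f \<oplus> g) \<cdot> \<epsilon> B = (\<Delta> A \<cdot> (ba f \<otimes> ba g) \<cdot> mult B) \<cdot> \<epsilon> B" ..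
  \<comment> \<open>The composite passes through the coalgebras
    \<open>\<delta> A \<boxtimes> \<delta> A\<close> and
    \<open>\<delta> B \<boxtimes> \<delta> B\<close>.\<close>
  moreover have "coalgebra_hom (\<delta> A) (\<delta> B) (\<Delta> A \<cdot> (ba f \<otimes> ba g) \<cdot> mult B)"
    using f g coalgebra_hom_ba[of f] coalgebra_hom_ba[of g]
    by (intro coalgebra_hom_comp[of _ "\<delta> B \<boxtimes> \<delta> B"] coalgebra_hom_comp[of _ "\<delta> A \<boxtimes> \<delta> A"]
        coalgebra_hom_tensor coalgebra_hom_mult coalgebra_hom_\<Delta>) auto
  ultimately show ?thesis
    using f g coalgebra_hom_ba[of "f \<oplus> g"] by - (rule cofree_unique[of "\<delta> A" B], auto)
qed

section \<open>Assembly of the additive bialgebra modality\<close>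

lemma additive_bialgebra_modality_mult_unit:
  "additive_bialgebra_modality X bo ba \<delta> \<epsilon> \<Delta> e mult unit"
proof unfold_locales
\<comment> \<open>In \<open>ba_add\<close> the objects \<open>A\<close> and \<open>B\<close> are
  absent from the left-hand side; the two \<open>refl\<close> instantiate them to the source and
  target of \<open>f\<close>, which makes it a rewrite rule.\<close>
qed (auto simp: hom_iff mult_natural unit_natural mult_assoc mult_unit mult_comm mult_e unit_\<Delta> unit_e
    mult_\<Delta> mult_\<epsilon> ba_add[OF _ _ refl refl] ba_zero)

end

theorem proposition3p6:
  fixes X :: "('o, 'a, 'm) asmcat_scheme" (structure)
    and bo :: "'o \<Rightarrow> 'o" and ba :: "'a \<Rightarrow> 'a"
    and \<delta> \<epsilon> \<Delta> e :: "'o \<Rightarrow> 'a"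
    and m :: "'o \<Rightarrow> 'o \<Rightarrow> 'a" and m\<^sub>K :: 'a
  assumes "additive_linear_category X bo ba \<delta> \<epsilon> m m\<^sub>K \<Delta> e"
  shows "additive_bialgebra_modality X bo ba \<delta> \<epsilon> \<Delta> e
    (\<lambda>A. (\<delta> A \<otimes> \<delta> A) \<cdot> m (bo A) (bo A) \<cdot> ba (\<epsilon> A \<otimes> e A \<oplus> e A \<otimes> \<epsilon> A))
    (\<lambda>A. m\<^sub>K \<cdot> ba (\<zero> \<K> A))"
proof -
  interpret additive_linear_category X bo ba \<delta> \<epsilon> m m\<^sub>K \<Delta> e
    by (fact assms)
  show ?thesis
    using additive_bialgebra_modality_mult_unit by (simp add: mult_def[abs_def] unit_def[abs_def])
qed

end
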